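(* Let $S_1,S_2\subseteq\mathbb{Z}^{+}$ and let $n,k\ge 0$ be integers. Let $\mathcal{L}_{S_1,S_2}(n,k)$ be the set of $(S_1,S_2)$-restricted lonesum matrices with $n$ rows and $k$ columns having no all-zero row and no all-zero column. Then $$|\mathcal{L}_{S_1,S_2}(n,k)|=\sum_{m=0}^{\min(n,k)} m!{n\brace m}_{S_1}\, m!{k\brace m}_{S_2}.$$
   Context: $\mathbb{Z}^{+}$ is the set of positive integers. For $S\subseteq\mathbb{Z}^{+}$, ${n\brace k}_S$ denotes the number of partitions of $[n]=\{1,\dots,n\}$ into exactly $k$ (non-empty) blocks such that the size of each block belongs to $S$ (so ${0\brace 0}_S=1$). A lonesum matrix is a $(0,1)$-matrix that is uniquely determined, among $(0,1)$-matrices of the same size, by its row sum vector and column sum vector. Two rows (resp. columns) of a matrix have the same type if they coincide in every position. A lonesum matrix is $(S_1,S_2)$-restricted if for every row occurring in it, the number of rows of the same type belongs to $S_1$, and for every column occurring in it, the number of columns of the same type belongs to $S_2$. Convention for empty matrices: for each $n,k$ with $nk=0$ there is exactly one $n\times k$ matrix, and it is lonesum; all rows of an $n\times 0$ matrix and all columns of a $0\times k$ matrix count as all-zero. *)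

theory Defs
  imports "Jordan_Normal_Form.Matrix" "HOL-Library.Disjoint_Sets"
begin

definition restricted_Stirling :: "nat set \<Rightarrow> nat \<Rightarrow> nat \<Rightarrow> nat" where
  "restricted_Stirling S n k =
     card {P. partition_on {1..n} P \<and> card P = k \<and> (\<forall>B\<in>P. card B \<in> S)}"

definition zero_one_mats :: "nat \<Rightarrow> nat \<Rightarrow> nat mat set" where
  "zero_one_mats n k =
     {A \<in> carrier_mat n k. \<forall>i<n. \<forall>j<k. A $$ (i, j) \<in> {0, 1}}"

definition row_sum_vec :: "nat mat \<Rightarrow> nat vec" where
  "row_sum_vec A = vec (dim_row A) (\<lambda>i. \<Sum>j<dim_col A. A $$ (i, j))"

definition col_sum_vec :: "nat mat \<Rightarrow> nat vec" where
  "col_sum_vec A = vec (dim_col A) (\<lambda>j. \<Sum>i<dim_row A. A $$ (i, j))"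

definition lonesum :: "nat mat \<Rightarrow> bool" where
  "lonesum A \<longleftrightarrow>
     A \<in> zero_one_mats (dim_row A) (dim_col A) \<and>
     (\<forall>B \<in> zero_one_mats (dim_row A) (dim_col A).
        row_sum_vec B = row_sum_vec A \<and> col_sum_vec B = col_sum_vec A \<longrightarrow> B = A)"

definition type_restricted :: "nat set \<Rightarrow> nat set \<Rightarrow> nat mat \<Rightarrow> bool" where
  "type_restricted S1 S2 A \<longleftrightarrow>
     (\<forall>i<dim_row A. card {i'. i' < dim_row A \<and> row A i' = row A i} \<in> S1) \<and>
     (\<forall>j<dim_col A. card {j'. j' < dim_col A \<and> col A j' = col A j} \<in> S2)"

(* Type "nat mat" records the dimensions, so carrier_mat n k has exactly one element when
   n * k = 0. The rows of an n x 0 matrix equal the zero vector of dimension 0 and hence count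
   as all-zero; likewise the columns of a 0 x k matrix. *)
definition restricted_lonesum_mats :: "nat set \<Rightarrow> nat set \<Rightarrow> nat \<Rightarrow> nat \<Rightarrow> nat mat set" where
  "restricted_lonesum_mats S1 S2 n k =
     {A \<in> carrier_mat n k. lonesum A \<and> type_restricted S1 S2 A \<and>
        (\<forall>i<n. row A i \<noteq> 0\<^sub>v k) \<and> (\<forall>j<k. col A j \<noteq> 0\<^sub>v n)}"

end

(* A (0,1)-matrix is lonesum iff the supports of its rows form a chain under inclusion. If there
   is no zero row and no zero column and there are m distinct row supports, then ranking the row
   supports by inclusion and the columns by the number of distinct supports that miss them gives
   surjections f and g from the row and column indices onto {0,...,m-1} such that the (i,j) entry
   is 1 iff g j <= f i. The pair (f,g) is determined by the matrix, its fibres are the classes of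
   equal rows and of equal columns, and a surjection onto {0,...,m-1} is a set partition into m
   blocks together with one of the m! orderings of the blocks. *)

theory Submission imports Defs "HOL-Library.FuncSet" begin

subsection \<open>Surjections and ordered set partitions\<close>

text \<open>Extensionality fixes the values outside \<open>A\<close>, so that cardinalities count
  surjections on \<open>A\<close> only. By surjectivity the size condition at the points of
  \<open>A\<close> covers every fibre over \<open>{..<m}\<close>.\<close>

definition fibre_surjections :: "nat set \<Rightarrow> 'a set \<Rightarrow> nat \<Rightarrow> ('a \<Rightarrow> nat) set" where
  "fibre_surjections S A m =
     {f \<in> extensional A. f ` A = {..<m} \<and> (\<forall>a\<in>A. card {b \<in> A. f b = f a} \<in> S)}"

definition block_partitions :: "nat set \<Rightarrow> 'a set \<Rightarrow> nat \<Rightarrow> 'a set set set" where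
  "block_partitions S A m = {P. partition_on A P \<and> card P = m \<and> (\<forall>B\<in>P. card B \<in> S)}"

text \<open>An ordering of the blocks is encoded as an injective enumeration, with
  \<open>c t\<close> the block in position \<open>t\<close>.\<close>

definition ordered_partitions :: "nat set \<Rightarrow> 'a set \<Rightarrow> nat \<Rightarrow> (nat \<Rightarrow> 'a set) set" where
  "ordered_partitions S A m =
     {c \<in> extensional {..<m}. inj_on c {..<m} \<and> c ` {..<m} \<in> block_partitions S A m}"

lemma finite_block_partitions: "finite A \<Longrightarrow> finite (block_partitions S A m)"
  unfolding block_partitions_def by (rule finite_subset[OF _ finitely_many_partition_on]) auto

lemma card_inj_funcset:
  assumes "finite P"
  shows "card {c \<in> {..<card P} \<rightarrow>\<^sub>E P. inj_on c {..<card P}} = fact (card P)"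
  using card_inj_on_subset_funcset[of "{..<card P}" P "{..<card P}"] assms
  by (simp add: fact_prod_rev)

text \<open>Sorting the enumerations by their image \<open>P\<close> gives disjoint classes, one for
  each partition, and each class consists of the \<open>m!\<close> bijections from
  \<open>{..<m}\<close> to \<open>P\<close>.\<close>

lemma card_ordered_partitions:
  assumes "finite A"
  shows "card (ordered_partitions S A m) = fact m * card (block_partitions S A m)"
proof -
  let ?C = "\<lambda>P. {c \<in> {..<m} \<rightarrow>\<^sub>E P. inj_on c {..<m}}"
  have fin: "finite P" "card P = m" if "P \<in> block_partitions S A m" for P
    using that finite_elements[OF assms] by (auto simp: block_partitions_def)
  \<comment> \<open>An injection from \<open>m\<close> elements into a set of \<open>m\<close>
    elements is onto, so an enumeration determines its partition; this makes the classes
    disjoint.\<close>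
  have img: "c ` {..<m} = P" if "P \<in> block_partitions S A m" "c \<in> ?C P" for P c
    using that fin[OF that(1)] by (intro card_subset_eq) (auto simp: card_image)
  have "ordered_partitions S A m = (\<Union>P \<in> block_partitions S A m. ?C P)"
  proof (intro equalityI subsetI)
    fix c assume "c \<in> ordered_partitions S A m"
    then show "c \<in> (\<Union>P \<in> block_partitions S A m. ?C P)"
      by (intro UN_I[of "c ` {..<m}"]) (auto simp: ordered_partitions_def PiE_def)
  next
    fix c assume "c \<in> (\<Union>P \<in> block_partitions S A m. ?C P)"
    then obtain P where P: "P \<in> block_partitions S A m" "c \<in> ?C P" by blast
    then show "c \<in> ordered_partitions S A m"
      using img[OF P] by (auto simp: ordered_partitions_def PiE_def)
  qed
  also have "card \<dots> = (\<Sum>P \<in> block_partitions S A m. card (?C P))"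
  proof (rule card_UN_disjoint)
    show "finite (block_partitions S A m)" using assms by (rule finite_block_partitions)
    show "\<forall>P \<in> block_partitions S A m. finite (?C P)"
    proof
      fix P assume "P \<in> block_partitions S A m"
      then have "finite ({..<m} \<rightarrow>\<^sub>E P)" using fin by (intro finite_PiE) auto
      then show "finite (?C P)" by simp
    qed
    show "\<forall>P \<in> block_partitions S A m. \<forall>Q \<in> block_partitions S A m.
        P \<noteq> Q \<longrightarrow> ?C P \<inter> ?C Q = {}"
    proof (intro ballI impI equals0I)
      fix P Q c assume "P \<in> block_partitions S A m" "Q \<in> block_partitions S A m"
        and "P \<noteq> Q" "c \<in> ?C P \<inter> ?C Q"
      then show False using img[of P c] img[of Q c] by simp
    qed
  qed
  also have "\<dots> = (\<Sum>P \<in> block_partitions S A m. fact m)"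
  proof (intro sum.cong refl)
    fix P assume "P \<in> block_partitions S A m"
    then show "card (?C P) = fact m" using fin[of P] card_inj_funcset[of P] by simp
  qed
  finally show ?thesis by simp
qed

text \<open>The inverse map sends a point to the index of the block that contains it.\<close>

lemma bij_betw_fibres:
  "bij_betw (\<lambda>f. \<lambda>t\<in>{..<m}. {a \<in> A. f a = t}) (fibre_surjections S A m) (ordered_partitions S A m)"
proof (rule bij_betwI')
  fix f g assume f: "f \<in> fibre_surjections S A m" and g: "g \<in> fibre_surjections S A m"
  have "f = g" if eq: "(\<lambda>t\<in>{..<m}. {a \<in> A. f a = t}) = (\<lambda>t\<in>{..<m}. {a \<in> A. g a = t})"
  proof (rule extensionalityI)
    show "f \<in> extensional A" "g \<in> extensional A"
      using f g by (auto simp: fibre_surjections_def)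
    fix a assume a: "a \<in> A"
    then have "f a < m" using f by (auto simp: fibre_surjections_def)
    then have "{b \<in> A. f b = f a} = {b \<in> A. g b = f a}"
      using fun_cong[OF eq, of "f a"] by simp
    moreover have "a \<in> {b \<in> A. f b = f a}" using a by simp
    ultimately show "f a = g a" by simp
  qed
  then show "((\<lambda>t\<in>{..<m}. {a \<in> A. f a = t}) = (\<lambda>t\<in>{..<m}. {a \<in> A. g a = t})) = (f = g)"
    by blast
next
  fix f assume f: "f \<in> fibre_surjections S A m"
  let ?c = "\<lambda>t\<in>{..<m}. {a \<in> A. f a = t}"
  have im: "f ` A = {..<m}" and S: "\<And>a. a \<in> A \<Longrightarrow> card {b \<in> A. f b = f a} \<in> S"
    using f by (auto simp: fibre_surjections_def)
  have ex: "\<exists>a\<in>A. f a = t" if "t < m" for t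
    using that im by (metis imageE lessThan_iff)
  have lt: "f a < m" if "a \<in> A" for a using that im by blast
  have inj: "inj_on ?c {..<m}"
  proof (rule inj_onI)
    fix s t assume st: "s \<in> {..<m}" "t \<in> {..<m}" "?c s = ?c t"
    then obtain a where "a \<in> A" "f a = s" using ex by auto
    moreover have "{a \<in> A. f a = s} = {a \<in> A. f a = t}" using st by simp
    ultimately show "s = t" by (metis (mono_tags, lifting) mem_Collect_eq)
  qed
  have "partition_on A (?c ` {..<m})"
    using ex lt by (intro partition_onI) (auto simp: disjnt_def)
  moreover have "card (?c t) \<in> S" if "t < m" for t
    using ex[OF that] S that by auto
  ultimately show "?c \<in> ordered_partitions S A m"
    using inj by (auto simp: ordered_partitions_def block_partitions_def card_image)
next
  fix c assume c: "c \<in> ordered_partitions S A m"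
  have ext: "c \<in> extensional {..<m}" and inj: "inj_on c {..<m}"
    and part: "partition_on A (c ` {..<m})" and S: "\<And>t. t < m \<Longrightarrow> card (c t) \<in> S"
    using c by (auto simp: ordered_partitions_def block_partitions_def)
  have un: "A = (\<Union>t<m. c t)" using partition_onD1[OF part] by simp
  have disj: "s = t" if "s < m" "t < m" "a \<in> c s" "a \<in> c t" for s t a
  proof -
    have "c s = c t" using partition_onD2[OF part] that by (auto simp: disjoint_def)
    then show ?thesis using inj that by (auto dest: inj_onD)
  qed
  have ne: "c t \<noteq> {}" if "t < m" for t
    using partition_onD3[OF part] that by (metis image_eqI lessThan_iff)
  \<comment> \<open>The index is unique because distinct blocks are disjoint and \<open>c\<close> is
    injective.\<close>
  define f where "f = (\<lambda>a\<in>A. THE t. t < m \<and> a \<in> c t)"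
  have f: "f a = t" if "t < m" "a \<in> c t" for a t
  proof -
    have "a \<in> A" using un that by auto
    moreover have "(THE t. t < m \<and> a \<in> c t) = t"
      using that disj by (intro the_equality) auto
    ultimately show ?thesis by (simp add: f_def)
  qed
  have fib: "{a \<in> A. f a = t} = c t" if "t < m" for t
    using un f that by auto
  have "f ` A = {..<m}"
  proof (intro equalityI subsetI)
    fix t assume "t \<in> f ` A"
    then show "t \<in> {..<m}" using un f by auto
  next
    fix t assume t: "t \<in> {..<m}"
    then obtain a where "a \<in> c t" using ne by auto
    then show "t \<in> f ` A" using un f t by (intro image_eqI[of _ _ a]) auto
  qed
  moreover from this have "card {b \<in> A. f b = f a} \<in> S" if "a \<in> A" for a
  proof -
    have "f a < m" using that \<open>f ` A = {..<m}\<close> by auto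
    then show ?thesis using fib S by simp
  qed
  ultimately have "f \<in> fibre_surjections S A m"
    by (simp add: fibre_surjections_def f_def)
  moreover have "c = (\<lambda>t\<in>{..<m}. {a \<in> A. f a = t})"
    using ext fib by (intro extensionalityI[of _ "{..<m}"]) auto
  ultimately show "\<exists>f\<in>fibre_surjections S A m. c = (\<lambda>t\<in>{..<m}. {a \<in> A. f a = t})" by blast
qed

section \<open>Counting surjections by Stirling numbers\<close>

lemma card_fibre_surjections:
  "finite A \<Longrightarrow> card (fibre_surjections S A m) = fact m * card (block_partitions S A m)"
  using bij_betw_same_card[OF bij_betw_fibres] card_ordered_partitions by metis

lemma finite_fibre_surjections:
  assumes "finite A"
  shows "finite (fibre_surjections S A m)"
proof (rule finite_subset)
  show "fibre_surjections S A m \<subseteq> A \<rightarrow>\<^sub>E {..<m}"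
    by (auto simp: fibre_surjections_def PiE_def)
  show "finite (A \<rightarrow>\<^sub>E {..<m})" using assms by (intro finite_PiE) auto
qed

text \<open>Taking images under \<open>h\<close> transports partitions injectively and keeps the
  block sizes. Applied to \<open>h\<close> and to its inverse, the inequality becomes an
  equality.\<close>

lemma card_block_partitions_le:
  assumes h: "bij_betw h A B" and "finite B"
  shows "card (block_partitions S A m) \<le> card (block_partitions S B m)"
proof (rule card_inj_on_le[where f = "\<lambda>P. (`) h ` P"])
  have inj: "inj_on h A" and im: "h ` A = B" using h by (auto simp: bij_betw_def)
  have inj': "inj_on ((`) h) (Pow A)" using inj by (rule inj_on_image_Pow)
  have sub: "block_partitions S A m \<subseteq> Pow (Pow A)"
    by (auto simp: block_partitions_def partition_on_def)
  show "inj_on (\<lambda>P. (`) h ` P) (block_partitions S A m)"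
    using inj_on_image_Pow[OF inj'] sub by (rule inj_on_subset)
  show "finite (block_partitions S B m)" using assms(2) by (rule finite_block_partitions)
  show "(\<lambda>P. (`) h ` P) ` block_partitions S A m \<subseteq> block_partitions S B m"
  proof clarify
    fix P assume P: "P \<in> block_partitions S A m"
    then have part: "partition_on A P" and PA: "P \<subseteq> Pow A"
      using sub by (auto simp: block_partitions_def)
    have "{} \<notin> (`) h ` P" using partition_onD3[OF part] by auto
    then have "partition_on B ((`) h ` P)"
      using partition_on_inj_image[OF part inj] im by simp
    moreover have "card ((`) h ` P) = card P"
      using inj_on_subset[OF inj' PA] by (rule card_image)
    moreover have "card (h ` X) = card X" if "X \<in> P" for X
      using that PA inj by (intro card_image) (auto intro: inj_on_subset)
    ultimately show "(`) h ` P \<in> block_partitions S B m"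
      using P by (auto simp: block_partitions_def)
  qed
qed

lemma card_fibre_surjections_lessThan:
  "card (fibre_surjections S {..<n} m) = fact m * restricted_Stirling S n m"
proof -
  \<comment> \<open>Matrix indices start at 0, whereas \<open>restricted_Stirling\<close> partitions
    \<open>{1..n}\<close>.\<close>
  have h: "bij_betw Suc {..<n} {1..n}"
    by (simp add: bij_betw_def image_Suc_lessThan)
  have "card (block_partitions S {..<n} m) = card (block_partitions S {1..n} m)"
    using card_block_partitions_le[OF h] card_block_partitions_le[OF bij_betw_inv_into[OF h]]
    by (intro antisym) auto
  then show ?thesis
    by (simp add: card_fibre_surjections restricted_Stirling_def block_partitions_def)
qed

text \<open>Induction on \<open>f a\<close>: by surjectivity some \<open>b\<close> has the value one
  lower, and \<open>f'\<close> grows strictly from \<open>b\<close> to \<open>a\<close>.\<close>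

lemma surjection_le_of_strict_mono:
  fixes f f' :: "'a \<Rightarrow> nat"
  assumes "f ` A = {..<m}"
    and "\<And>x y. x \<in> A \<Longrightarrow> y \<in> A \<Longrightarrow> f x < f y \<Longrightarrow> f' x < f' y"
    and "a \<in> A"
  shows "f a \<le> f' a"
  using assms(3)
proof (induction "f a" arbitrary: a)
  case (Suc t)
  have "t \<in> f ` A" using Suc.hyps(2) Suc.prems assms(1) by (metis Suc_lessD image_eqI lessThan_iff)
  then obtain b where b: "b \<in> A" "f b = t" by blast
  then have "t \<le> f' b" using Suc.hyps(1)[of b] by simp
  also have "f' b < f' a" using b Suc by (intro assms(2)) auto
  finally show ?case using Suc.hyps(2) by simp
qed simp

text \<open>A surjection onto an initial segment is the rank function of the preorder it induces.
  Each of the two functions is strictly monotone relative to the other, so the preceding bound holds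
  in both directions.\<close>

lemma surjections_unique:
  fixes f f' :: "'a \<Rightarrow> nat"
  assumes "f \<in> fibre_surjections S A m" "f' \<in> fibre_surjections S A m'"
    and le: "\<And>x y. x \<in> A \<Longrightarrow> y \<in> A \<Longrightarrow> f x \<le> f y \<longleftrightarrow> f' x \<le> f' y"
  shows "f = f' \<and> m = m'"
proof -
  have im: "f ` A = {..<m}" "f' ` A = {..<m'}" and ext: "f \<in> extensional A" "f' \<in> extensional A"
    using assms by (auto simp: fibre_surjections_def)
  have "f a = f' a" if "a \<in> A" for a
  proof (rule antisym)
    show "f a \<le> f' a"
      by (rule surjection_le_of_strict_mono[OF im(1) _ that]) (use le in \<open>auto simp: not_le[symmetric]\<close>)
    show "f' a \<le> f a"
      by (rule surjection_le_of_strict_mono[OF im(2) _ that]) (use le in \<open>auto simp: not_le[symmetric]\<close>)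
  qed
  then have "f = f'" using ext by (intro extensionalityI)
  then show ?thesis using im by simp
qed

subsection \<open>Threshold matrices\<close>

definition threshold_mat :: "nat \<Rightarrow> nat \<Rightarrow> (nat \<Rightarrow> nat) \<Rightarrow> (nat \<Rightarrow> nat) \<Rightarrow> nat mat" where
  "threshold_mat n k f g = mat n k (\<lambda>(i, j). if g j \<le> f i then 1 else 0)"

lemma dim_threshold_mat [simp]:
  "dim_row (threshold_mat n k f g) = n" "dim_col (threshold_mat n k f g) = k"
  "threshold_mat n k f g \<in> carrier_mat n k"
  by (auto simp: threshold_mat_def)

lemma index_threshold_mat [simp]:
  "i < n \<Longrightarrow> j < k \<Longrightarrow> threshold_mat n k f g $$ (i, j) = (if g j \<le> f i then 1 else 0)"
  by (simp add: threshold_mat_def)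

(* The weight w(i,j) = 2 (f i - g j) + 1 is never 0 and is positive exactly on the support of the
   threshold matrix A. The w-weighted sum of the entries depends only on the row and column sums,
   and A is the unique (0,1)-matrix that maximises it. *)
lemma lonesum_threshold_mat: "lonesum (threshold_mat n k f g)"
  unfolding lonesum_def dim_threshold_mat
proof (intro conjI ballI impI)
  let ?A = "threshold_mat n k f g"
  show "?A \<in> zero_one_mats n k" by (auto simp: zero_one_mats_def)
  fix B assume B: "B \<in> zero_one_mats n k"
    and sums: "row_sum_vec B = row_sum_vec ?A \<and> col_sum_vec B = col_sum_vec ?A"
  have dim: "dim_row B = n" "dim_col B = k" and B01: "\<And>i j. i < n \<Longrightarrow> j < k \<Longrightarrow> B $$ (i, j) \<in> {0, 1}"
    using B by (auto simp: zero_one_mats_def)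
  define D where "D i j = int (?A $$ (i, j)) - int (B $$ (i, j))" for i j
  define w where "w i j = 2 * (int (f i) - int (g j)) + 1" for i j
  have row: "(\<Sum>j<k. D i j) = 0" if "i < n" for i
  proof -
    have "row_sum_vec B $ i = row_sum_vec ?A $ i" using sums by simp
    then have "(\<Sum>j<k. B $$ (i, j)) = (\<Sum>j<k. ?A $$ (i, j))"
      using that dim by (simp add: row_sum_vec_def)
    then show ?thesis unfolding D_def sum_subtractf of_nat_sum[symmetric] by simp
  qed
  have col: "(\<Sum>i<n. D i j) = 0" if "j < k" for j
  proof -
    have "col_sum_vec B $ j = col_sum_vec ?A $ j" using sums by simp
    then have "(\<Sum>i<n. B $$ (i, j)) = (\<Sum>i<n. ?A $$ (i, j))"
      using that dim by (simp add: col_sum_vec_def)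
    then show ?thesis unfolding D_def sum_subtractf of_nat_sum[symmetric] by simp
  qed
  have "(\<Sum>i<n. \<Sum>j<k. D i j * w i j) =
      (\<Sum>i<n. \<Sum>j<k. (2 * int (f i) + 1) * D i j) - (\<Sum>i<n. \<Sum>j<k. 2 * int (g j) * D i j)"
    by (simp add: w_def sum_subtractf[symmetric] algebra_simps)
  also have "(\<Sum>i<n. \<Sum>j<k. (2 * int (f i) + 1) * D i j) = 0"
    using row by (simp add: sum_distrib_left[symmetric])
  also have "(\<Sum>i<n. \<Sum>j<k. 2 * int (g j) * D i j) = 0"
    using col by (subst sum.swap) (simp add: sum_distrib_left[symmetric])
  finally have total: "(\<Sum>i<n. \<Sum>j<k. D i j * w i j) = 0" by simp
  \<comment> \<open>On the support of the threshold matrix \<open>D\<close> is 0 or 1 and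
    \<open>w\<close> is positive; off the support \<open>D\<close> is 0 or -1 and \<open>w\<close>
    is negative.\<close>
  have nonneg: "0 \<le> D i j * w i j" if "i < n" "j < k" for i j
    using B01[OF that] that by (auto simp: D_def w_def)
  have w0: "w i j \<noteq> 0" for i j unfolding w_def by presburger
  have D0: "D i j = 0" if "i < n" "j < k" for i j
  proof -
    have "(\<Sum>j<k. D i j * w i j) = 0"
      using total nonneg that(1) by (subst (asm) sum_nonneg_eq_0_iff) (auto intro: sum_nonneg)
    then have "D i j * w i j = 0"
      using nonneg that by (subst (asm) sum_nonneg_eq_0_iff) auto
    then show ?thesis using w0 by simp
  qed
  show "B = ?A"
    by (rule eq_matI) (use D0 dim in \<open>auto simp: D_def\<close>)
qed

text \<open>Since \<open>f\<close> and \<open>g\<close> have the same image, each row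
  \<open>i\<close> has a column \<open>j\<close> with \<open>g j = f i\<close>, and the entries in
  that column decide the comparison. Columns are compared likewise, in reversed order because a
  larger threshold \<open>g j\<close> shrinks the column.\<close>

lemma
  assumes f: "f ` {..<n} = {..<m}" and g: "g ` {..<k} = {..<m}"
  shows threshold_row_le_iff: "\<lbrakk>i < n; i' < n\<rbrakk> \<Longrightarrow> f i \<le> f i' \<longleftrightarrow>
      (\<forall>j<k. threshold_mat n k f g $$ (i, j) \<le> threshold_mat n k f g $$ (i', j))"
    and threshold_col_le_iff: "\<lbrakk>j < k; j' < k\<rbrakk> \<Longrightarrow> g j \<le> g j' \<longleftrightarrow>
      (\<forall>i<n. threshold_mat n k f g $$ (i, j') \<le> threshold_mat n k f g $$ (i, j))"
proof -
  have fg: "f i \<in> g ` {..<k}" if "i < n" for i using f g that by auto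
  have gf: "g j \<in> f ` {..<n}" if "j < k" for j using f g that by auto
  show "f i \<le> f i' \<longleftrightarrow>
      (\<forall>j<k. threshold_mat n k f g $$ (i, j) \<le> threshold_mat n k f g $$ (i', j))"
    if "i < n" "i' < n"
  proof
    assume "\<forall>j<k. threshold_mat n k f g $$ (i, j) \<le> threshold_mat n k f g $$ (i', j)"
    moreover obtain j where "j < k" "g j = f i" using fg[OF \<open>i < n\<close>] by auto
    ultimately show "f i \<le> f i'" using that by (auto split: if_splits)
  qed (use that in auto)
  show "g j \<le> g j' \<longleftrightarrow>
      (\<forall>i<n. threshold_mat n k f g $$ (i, j') \<le> threshold_mat n k f g $$ (i, j))"
    if "j < k" "j' < k"
  proof
    assume "\<forall>i<n. threshold_mat n k f g $$ (i, j') \<le> threshold_mat n k f g $$ (i, j)"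
    moreover obtain i where "i < n" "f i = g j'" using gf[OF \<open>j' < k\<close>] by force
    ultimately show "g j \<le> g j'" using that by (auto split: if_splits)
  qed (use that in auto)
qed

text \<open>Equality of rows or columns is entrywise inequality in both directions, so antisymmetry
  reduces it to the preceding comparisons.\<close>

lemma
  assumes f: "f ` {..<n} = {..<m}" and g: "g ` {..<k} = {..<m}"
  shows threshold_row_eq_iff: "\<lbrakk>i < n; i' < n\<rbrakk> \<Longrightarrow>
      row (threshold_mat n k f g) i = row (threshold_mat n k f g) i' \<longleftrightarrow> f i = f i'"
    and threshold_col_eq_iff: "\<lbrakk>j < k; j' < k\<rbrakk> \<Longrightarrow>
      col (threshold_mat n k f g) j = col (threshold_mat n k f g) j' \<longleftrightarrow> g j = g j'"
proof -
  show "row (threshold_mat n k f g) i = row (threshold_mat n k f g) i' \<longleftrightarrow> f i = f i'"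
    if "i < n" "i' < n"
    unfolding vec_eq_iff eq_iff[of "f i"] threshold_row_le_iff[OF f g that]
      threshold_row_le_iff[OF f g that(2,1)]
    using that by (auto split: if_splits)
  show "col (threshold_mat n k f g) j = col (threshold_mat n k f g) j' \<longleftrightarrow> g j = g j'"
    if "j < k" "j' < k"
    unfolding vec_eq_iff eq_iff[of "g j"] threshold_col_le_iff[OF f g that]
      threshold_col_le_iff[OF f g that(2,1)]
    using that by (auto split: if_splits)
qed

lemma type_restricted_threshold_iff:
  assumes f: "f ` {..<n} = {..<m}" and g: "g ` {..<k} = {..<m}"
  shows "type_restricted S1 S2 (threshold_mat n k f g) \<longleftrightarrow>
    (\<forall>i<n. card {i' \<in> {..<n}. f i' = f i} \<in> S1) \<and>
    (\<forall>j<k. card {j' \<in> {..<k}. g j' = g j} \<in> S2)"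
proof -
  have "{i'. i' < n \<and> row (threshold_mat n k f g) i' = row (threshold_mat n k f g) i} =
      {i' \<in> {..<n}. f i' = f i}" if "i < n" for i
    using threshold_row_eq_iff[OF f g _ that] by auto
  moreover have "{j'. j' < k \<and> col (threshold_mat n k f g) j' = col (threshold_mat n k f g) j} =
      {j' \<in> {..<k}. g j' = g j}" if "j < k" for j
    using threshold_col_eq_iff[OF f g _ that] by auto
  ultimately show ?thesis by (simp add: type_restricted_def)
qed

section \<open>Pairs of surjections as parameters of the matrices\<close>

lemma threshold_mat_in_restricted_lonesum_mats:
  assumes "f \<in> fibre_surjections S1 {..<n} m" "g \<in> fibre_surjections S2 {..<k} m"
  shows "threshold_mat n k f g \<in> restricted_lonesum_mats S1 S2 n k"
proof -
  let ?A = "threshold_mat n k f g"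
  have f: "f ` {..<n} = {..<m}" and g: "g ` {..<k} = {..<m}"
    using assms by (auto simp: fibre_surjections_def)
  have "row ?A i \<noteq> 0\<^sub>v k" if i: "i < n" for i
  proof
    assume eq: "row ?A i = 0\<^sub>v k"
    \<comment> \<open>The common image supplies a column whose threshold equals \<open>f i\<close>;
      the row has a 1 there.\<close>
    have "f i \<in> g ` {..<k}" using f g i by auto
    then obtain j where "j < k" "g j = f i" by auto
    then have "row ?A i $ j = 1" using i by simp
    then show False using eq \<open>j < k\<close> by simp
  qed
  moreover have "col ?A j \<noteq> 0\<^sub>v n" if j: "j < k" for j
  proof
    assume eq: "col ?A j = 0\<^sub>v n"
    have "g j \<in> f ` {..<n}" using f g j by auto
    then obtain i where "i < n" "f i = g j" by force
    then have "col ?A j $ i = 1" using j by simp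
    then show False using eq \<open>i < n\<close> by simp
  qed
  moreover have "type_restricted S1 S2 ?A"
    using assms by (auto simp: type_restricted_threshold_iff[OF f g] fibre_surjections_def)
  ultimately show ?thesis
    by (simp add: restricted_lonesum_mats_def lonesum_threshold_mat)
qed

text \<open>Entrywise comparison of rows and of columns reads the preorders of \<open>f\<close> and
  \<open>g\<close> off the matrix, and a preorder comes from only one surjection onto an initial
  segment.\<close>

lemma threshold_mat_unique:
  assumes fg: "f \<in> fibre_surjections S1 {..<n} m" "g \<in> fibre_surjections S2 {..<k} m"
    and fg': "f' \<in> fibre_surjections S1 {..<n} m'" "g' \<in> fibre_surjections S2 {..<k} m'"
    and eq: "threshold_mat n k f g = threshold_mat n k f' g'"
  shows "m = m' \<and> f = f' \<and> g = g'"
proof -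
  have im: "f ` {..<n} = {..<m}" "g ` {..<k} = {..<m}" "f' ` {..<n} = {..<m'}" "g' ` {..<k} = {..<m'}"
    using fg fg' by (auto simp: fibre_surjections_def)
  have "f = f' \<and> m = m'"
    using fg(1) fg'(1)
  proof (rule surjections_unique)
    show "f x \<le> f y \<longleftrightarrow> f' x \<le> f' y" if "x \<in> {..<n}" "y \<in> {..<n}" for x y
      using that threshold_row_le_iff[OF im(1,2), of x y] threshold_row_le_iff[OF im(3,4), of x y]
      unfolding eq by simp
  qed
  moreover have "g = g' \<and> m = m'"
    using fg(2) fg'(2)
  proof (rule surjections_unique)
    show "g x \<le> g y \<longleftrightarrow> g' x \<le> g' y" if "x \<in> {..<k}" "y \<in> {..<k}" for x y
      using that threshold_col_le_iff[OF im(1,2), of x y] threshold_col_le_iff[OF im(3,4), of x y]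
      unfolding eq by simp
  qed
  ultimately show ?thesis by blast
qed

subsection \<open>Finite chains of sets\<close>

definition chain_rank :: "'a set set \<Rightarrow> 'a set \<Rightarrow> nat" where
  "chain_rank R X = card {Y \<in> R. Y \<subset> X}"

text \<open>In a finite chain the members missing \<open>x\<close> form an initial segment, so for
  \<open>x\<close> in \<open>\<Union>R\<close> this is the rank of the least member containing
  \<open>x\<close>.\<close>

definition chain_corank :: "'a set set \<Rightarrow> 'a \<Rightarrow> nat" where
  "chain_corank R x = card {Y \<in> R. x \<notin> Y}"

text \<open>The rank increases strictly along the chain, and it stays below \<open>card R\<close>
  because \<open>X\<close> is not counted in its own rank. Injectivity and counting then give
  surjectivity.\<close>

lemma bij_betw_chain_rank:
  assumes fin: "finite R" and chain: "\<And>X Y. X \<in> R \<Longrightarrow> Y \<in> R \<Longrightarrow> X \<subseteq> Y \<or> Y \<subseteq> X"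
  shows "bij_betw (chain_rank R) R {..<card R}"
proof -
  have less: "chain_rank R X < chain_rank R Y" if "X \<in> R" "X \<subset> Y" for X Y
    unfolding chain_rank_def using that fin by (intro psubset_card_mono) auto
  have "inj_on (chain_rank R) R"
  proof (rule inj_onI, rule ccontr)
    fix X Y assume "X \<in> R" "Y \<in> R" "chain_rank R X = chain_rank R Y" "X \<noteq> Y"
    then show False using less[of X Y] less[of Y X] chain[of X Y] by auto
  qed
  moreover have "chain_rank R ` R \<subseteq> {..<card R}"
    unfolding chain_rank_def using fin by (auto intro!: psubset_card_mono)
  moreover from this have "chain_rank R ` R = {..<card R}"
    by (intro card_subset_eq) (simp_all add: card_image[OF \<open>inj_on (chain_rank R) R\<close>])
  ultimately show ?thesis by (simp add: bij_betw_def)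
qed

text \<open>If \<open>x \<in> X\<close>, every member missing \<open>x\<close> lies properly below
  \<open>X\<close>. If \<open>x \<notin> X\<close>, all members below \<open>X\<close> miss
  \<open>x\<close> and so does \<open>X\<close> itself, which makes the corank strictly
  larger.\<close>

lemma mem_chain_iff:
  assumes fin: "finite R" and chain: "\<And>X Y. X \<in> R \<Longrightarrow> Y \<in> R \<Longrightarrow> X \<subseteq> Y \<or> Y \<subseteq> X"
    and X: "X \<in> R"
  shows "x \<in> X \<longleftrightarrow> chain_corank R x \<le> chain_rank R X"
proof
  assume "x \<in> X"
  then show "chain_corank R x \<le> chain_rank R X"
    unfolding chain_rank_def chain_corank_def using fin chain[OF X] by (intro card_mono) auto
next
  assume le: "chain_corank R x \<le> chain_rank R X"
  show "x \<in> X"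
  proof (rule ccontr)
    assume "x \<notin> X"
    then have "chain_rank R X < chain_corank R x"
      unfolding chain_rank_def chain_corank_def using fin X by (intro psubset_card_mono) auto
    then show False using le by simp
  qed
qed

text \<open>A point of \<open>\<Union>R\<close> lies in some member, so its corank is below
  \<open>card R\<close>. Conversely, a point of the member of rank \<open>t\<close> that lies in no
  smaller member has corank \<open>t\<close>.\<close>

lemma chain_corank_image:
  assumes fin: "finite R" and chain: "\<And>X Y. X \<in> R \<Longrightarrow> Y \<in> R \<Longrightarrow> X \<subseteq> Y \<or> Y \<subseteq> X"
    and ne: "{} \<notin> R"
  shows "chain_corank R ` \<Union>R = {..<card R}"
proof (intro equalityI subsetI)
  fix t assume "t \<in> chain_corank R ` \<Union>R"
  then show "t \<in> {..<card R}"
    unfolding chain_corank_def using fin by (auto intro!: psubset_card_mono)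
next
  fix t assume "t \<in> {..<card R}"
  then obtain X where X: "X \<in> R" "chain_rank R X = t"
    using bij_betw_chain_rank[OF fin chain] by (metis bij_betw_iff_bijections)
  have "\<exists>x\<in>X. \<forall>Y\<in>R. Y \<subset> X \<longrightarrow> x \<notin> Y"
  proof (cases "{Y \<in> R. Y \<subset> X} = {}")
    case True
    \<comment> \<open>Here \<open>X\<close> is the least member; it has a point because
      \<open>{} \<notin> R\<close>.\<close>
    moreover have "X \<noteq> {}" using X(1) ne by metis
    ultimately show ?thesis by auto
  next
    case False
    let ?L = "{Y \<in> R. Y \<subset> X}"
    have "finite ?L" using fin by simp
    \<comment> \<open>In a chain a maximal element is greatest, so \<open>M\<close> contains every
      member properly below \<open>X\<close>, and any point of \<open>X\<close> outside
      \<open>M\<close> is new.\<close>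
    from finite_has_maximal[OF this False]
    obtain M where M: "M \<in> ?L" and max: "\<forall>Y\<in>?L. M \<subseteq> Y \<longrightarrow> M = Y"
      by (elim bexE)
    have "Y \<subseteq> M" if "Y \<in> ?L" for Y
    proof -
      have "Y \<subseteq> M \<or> M \<subseteq> Y" using chain[of Y M] that M by simp
      then show ?thesis using max that by (elim disjE) auto
    qed
    moreover obtain x where "x \<in> X" "x \<notin> M" using M by auto
    ultimately show ?thesis by auto
  qed
  then obtain x where x: "x \<in> X" "\<forall>Y\<in>R. Y \<subset> X \<longrightarrow> x \<notin> Y" by (elim bexE)
  have "x \<notin> Y \<longleftrightarrow> Y \<subset> X" if "Y \<in> R" for Y
    using x that chain[OF X(1) that] by auto
  then have "{Y \<in> R. x \<notin> Y} = {Y \<in> R. Y \<subset> X}" by auto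
  then have "chain_corank R x = t" using X(2) by (simp add: chain_corank_def chain_rank_def)
  then show "t \<in> chain_corank R ` \<Union>R" using x(1) X(1) by blast
qed

subsection \<open>The row supports of a lonesum matrix\<close>

text \<open>Flipping such a 2 by 2 pattern changes the matrix but none of its row and column
  sums.\<close>

lemma lonesum_no_switch:
  assumes A: "lonesum A" "A \<in> carrier_mat n k"
    and ij: "i < n" "i' < n" "j < k" "j' < k"
    and ent: "A $$ (i, j) = 1" "A $$ (i, j') = 0" "A $$ (i', j') = 1" "A $$ (i', j) = 0"
  shows False
proof -
  \<comment> \<open>\<open>transpose j j'\<close> is the transposition of two indices: columns
    \<open>j\<close> and \<open>j'\<close> are exchanged inside rows \<open>i\<close> and
    \<open>i'\<close> only. Each row is permuted, so its sum is kept.\<close>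
  define B where
    "B = mat n k (\<lambda>(p, q). A $$ (p, if p \<in> {i, i'} then transpose j j' q else q))"
  have dim: "dim_row A = n" "dim_col A = k" "dim_row B = n" "dim_col B = k"
    using A by (auto simp: B_def)
  have bij: "bij_betw (transpose a b) {..<l} {..<l}" if "a < l" "b < l" for a b l :: nat
    using that by (intro bij_betw_byWitness[where f' = "transpose a b"]) (auto simp: transpose_def)
  have "A \<in> zero_one_mats n k" using A dim by (simp add: lonesum_def)
  then have "B \<in> zero_one_mats n k"
    using ij by (auto simp: zero_one_mats_def B_def transpose_def)
  moreover have "row_sum_vec B = row_sum_vec A"
  proof (rule eq_vecI)
    fix p assume "p < dim_vec (row_sum_vec A)"
    then have p: "p < n" by (simp add: row_sum_vec_def dim)
    have "(\<Sum>q<k. A $$ (p, transpose j j' q)) = (\<Sum>q<k. A $$ (p, q))"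
      using ij by (intro sum.reindex_bij_betw bij)
    then have "(\<Sum>q<k. B $$ (p, q)) = (\<Sum>q<k. A $$ (p, q))"
      using p by (cases "p \<in> {i, i'}") (auto simp: B_def)
    then show "row_sum_vec B $ p = row_sum_vec A $ p"
      using p by (simp add: row_sum_vec_def dim)
  qed (simp add: row_sum_vec_def dim)
  moreover have "col_sum_vec B = col_sum_vec A"
  proof (rule eq_vecI)
    fix q assume "q < dim_vec (col_sum_vec A)"
    then have q: "q < k" by (simp add: col_sum_vec_def dim)
    have "(\<Sum>p<n. B $$ (p, q)) = (\<Sum>p<n. A $$ (p, q))"
    proof (cases "q \<in> {j, j'}")
      case True
      \<comment> \<open>The pattern is symmetric, so on these two columns the flip has the same
        effect as exchanging rows \<open>i\<close> and \<open>i'\<close>; column sums too are merely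
        reindexed.\<close>
      then have "B $$ (p, q) = A $$ (transpose i i' p, q)" if "p < n" for p
        using that q ent by (auto simp: B_def transpose_def)
      then have "(\<Sum>p<n. B $$ (p, q)) = (\<Sum>p<n. A $$ (transpose i i' p, q))" by simp
      also have "\<dots> = (\<Sum>p<n. A $$ (p, q))"
        using ij by (intro sum.reindex_bij_betw[of _ _ _ "\<lambda>p. A $$ (p, q)"] bij)
      finally show ?thesis .
    next
      case False
      then show ?thesis using q by (intro sum.cong) (auto simp: B_def transpose_def)
    qed
    then show "col_sum_vec B $ q = col_sum_vec A $ q"
      using q by (simp add: col_sum_vec_def dim)
  qed (simp add: col_sum_vec_def dim)
  ultimately have "B = A" using A(1) dim by (auto simp: lonesum_def)
  moreover have "B $$ (i, j) = 0" using ij ent by (simp add: B_def)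
  ultimately show False using ent by simp
qed

text \<open>Two incomparable row supports would contain the pattern excluded by
  \<open>lonesum_no_switch\<close>. The ranks of the supports and the coranks of the columns serve
  as \<open>f\<close> and \<open>g\<close>.\<close>

lemma restricted_lonesum_threshold:
  assumes A: "A \<in> restricted_lonesum_mats S1 S2 n k"
  obtains m f g where "f \<in> fibre_surjections S1 {..<n} m" "g \<in> fibre_surjections S2 {..<k} m"
    "A = threshold_mat n k f g"
proof -
  have carr: "A \<in> carrier_mat n k" and lone: "lonesum A" and ty: "type_restricted S1 S2 A"
    and row: "\<And>i. i < n \<Longrightarrow> row A i \<noteq> 0\<^sub>v k" and col: "\<And>j. j < k \<Longrightarrow> col A j \<noteq> 0\<^sub>v n"
    using A by (auto simp: restricted_lonesum_mats_def)
  have A01: "A $$ (i, j) = 0 \<or> A $$ (i, j) = 1" if "i < n" "j < k" for i j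
    using lone carr that by (auto simp: lonesum_def zero_one_mats_def)
  define supp where "supp i = {j. j < k \<and> A $$ (i, j) = 1}" for i
  define R where "R = supp ` {..<n}"
  have fin: "finite R" by (simp add: R_def)
  have chain: "X \<subseteq> Y \<or> Y \<subseteq> X" if XY: "X \<in> R" "Y \<in> R" for X Y
  proof (rule ccontr)
    assume "\<not> (X \<subseteq> Y \<or> Y \<subseteq> X)"
    then obtain j j' where "j \<in> X" "j \<notin> Y" "j' \<in> Y" "j' \<notin> X" by blast
    moreover obtain i i' where "i < n" "X = supp i" "i' < n" "Y = supp i'"
      using XY by (auto simp: R_def)
    ultimately have "i < n" "i' < n" "j < k" "j' < k" "A $$ (i, j) = 1" "A $$ (i, j') \<noteq> 1"
      "A $$ (i', j') = 1" "A $$ (i', j) \<noteq> 1" by (auto simp: supp_def)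
    then show False
      using lonesum_no_switch[OF lone carr, of i i' j j'] A01[of i j'] A01[of i' j] by metis
  qed
  \<comment> \<open>The absence of zero rows gives the hypothesis of
    \<open>chain_corank_image\<close>.\<close>
  have ne: "{} \<notin> R"
  proof
    assume "{} \<in> R"
    then obtain i where i: "i < n" "supp i = {}" by (auto simp: R_def)
    then have "row A i = 0\<^sub>v k" using A01 carr by (intro eq_vecI) (auto simp: supp_def)
    then show False using row i by simp
  qed
  \<comment> \<open>The absence of zero columns makes every column index a point of the chain, so
    that \<open>g\<close> takes all its values below \<open>card R\<close>.\<close>
  have un: "\<Union>R = {..<k}"
  proof (intro equalityI subsetI)
    fix j assume "j \<in> {..<k}"
    then have j: "j < k" by simp
    have "\<exists>i<n. A $$ (i, j) = 1"
    proof (rule ccontr)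
      assume "\<not> ?thesis"
      then have "col A j = 0\<^sub>v n" using A01 carr j by (intro eq_vecI) auto
      then show False using col j by simp
    qed
    then show "j \<in> \<Union>R" using j by (auto simp: R_def supp_def)
  qed (auto simp: R_def supp_def)
  define m f g where "m = card R" and "f = (\<lambda>i\<in>{..<n}. chain_rank R (supp i))"
    and "g = (\<lambda>j\<in>{..<k}. chain_corank R j)"
  have "f ` {..<n} = chain_rank R ` R" by (auto simp: f_def R_def image_image)
  then have f: "f ` {..<n} = {..<m}"
    using bij_betw_chain_rank[OF fin chain] by (simp add: bij_betw_def m_def)
  have g: "g ` {..<k} = {..<m}"
    using chain_corank_image[OF fin chain ne] by (simp add: un g_def m_def)
  have eq: "A = threshold_mat n k f g"
  proof (rule eq_matI)
    fix i j assume "i < dim_row (threshold_mat n k f g)" "j < dim_col (threshold_mat n k f g)"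
    then have ij: "i < n" "j < k" by simp_all
    then have "supp i \<in> R" by (simp add: R_def)
    then have "j \<in> supp i \<longleftrightarrow> g j \<le> f i"
      using mem_chain_iff[OF fin chain, of "supp i" j] ij by (simp add: f_def g_def)
    then show "A $$ (i, j) = threshold_mat n k f g $$ (i, j)"
      using ij A01[OF ij] by (auto simp: supp_def)
  qed (use carr in auto)
  \<comment> \<open>With \<open>A\<close> written as a threshold matrix, its type classes are the
    fibres of \<open>f\<close> and \<open>g\<close>.\<close>
  have "f \<in> fibre_surjections S1 {..<n} m" "g \<in> fibre_surjections S2 {..<k} m"
    using ty f g unfolding eq type_restricted_threshold_iff[OF f g]
    by (auto simp: fibre_surjections_def f_def g_def)
  then show ?thesis using eq that by blast
qed

section \<open>Counting the matrices through their parameters\<close>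

theorem theorem8:
  fixes S1 S2 :: "nat set" and n k :: nat
  assumes "S1 \<subseteq> {0<..}" and "S2 \<subseteq> {0<..}"
  shows "card (restricted_lonesum_mats S1 S2 n k) =
    (\<Sum>m=0..min n k. fact m * restricted_Stirling S1 n m * (fact m * restricted_Stirling S2 k m))"
proof -
  \<comment> \<open>The common image size \<open>m\<close> is part of the parameter, so the domain
    is counted by a sum over \<open>m\<close>. If exactly one of \<open>n\<close> and
    \<open>k\<close> is 0, the domain is empty, since a nonempty set has no surjection onto
    \<open>{..<0}\<close>.\<close>
  let ?D = "SIGMA m:{0..min n k}. fibre_surjections S1 {..<n} m \<times> fibre_surjections S2 {..<k} m"
  let ?T = "\<lambda>(m, f, g). threshold_mat n k f g"
  \<comment> \<open>A surjection onto \<open>m\<close> values needs at least \<open>m\<close>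
    arguments, so the range up to \<open>min n k\<close> loses no pair.\<close>
  have le: "m \<le> l" if "f \<in> fibre_surjections S {..<l} m" for f S l m
    using that card_image_le[of "{..<l}" f] by (auto simp: fibre_surjections_def)
  have "bij_betw ?T ?D (restricted_lonesum_mats S1 S2 n k)"
  proof (rule bij_betw_imageI)
    show "inj_on ?T ?D"
      by (rule inj_onI) (use threshold_mat_unique in fastforce)
    show "?T ` ?D = restricted_lonesum_mats S1 S2 n k"
    proof (intro equalityI subsetI)
      fix A assume "A \<in> restricted_lonesum_mats S1 S2 n k"
      then obtain m f g where *: "f \<in> fibre_surjections S1 {..<n} m"
        "g \<in> fibre_surjections S2 {..<k} m" "A = threshold_mat n k f g"
        by (rule restricted_lonesum_threshold)
      then have "(m, f, g) \<in> ?D" using le by auto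
      then show "A \<in> ?T ` ?D" using *(3) by force
    qed (auto intro: threshold_mat_in_restricted_lonesum_mats)
  qed
  then have "card (restricted_lonesum_mats S1 S2 n k) = card ?D"
    by (simp add: bij_betw_same_card)
  also have "\<dots> = (\<Sum>m=0..min n k. card (fibre_surjections S1 {..<n} m \<times> fibre_surjections S2 {..<k} m))"
    by (intro card_SigmaI) (auto intro: finite_fibre_surjections)
  finally show ?thesis by (simp add: card_cartesian_product card_fibre_surjections_lessThan)
qed

end
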